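(* Fix $\varepsilon\in(0,1/2)$ and an integer $k\ge2$. There exists a choice of $\alpha=\alpha(\varepsilon,k)>0$ such that for all sufficiently large $N$ (so that $P:=\lfloor\alpha N\rfloor\ge1$), the bipartite graph $U=(L,R;E)$ constructed below is an $(s,\varepsilon)$-PMRS with $n_0=N^{k+2}$ and $s=\Omega(n_0^{k/(k+2)})$. In particular, taking $k=2$ yields $s=\Omega(\sqrt{n_0})$. Construction: write $[N]=\{0,1,\dots,N-1\}$. Let $L$ and $R$ be two disjoint copies of $[N]^k\times[N^2]$, with elements written $(\mathbf x,z)_L$ and $(\mathbf y,t)_R$, so $n_0=|L|=|R|=N^{k+2}$. Let $A:=\{0,1,\dots,P\}^k\setminus\{\mathbf 0\}$ and $s:=|A|=(P+1)^k-1$. For $\mathbf a\in A$ let \[ M_{\mathbf a}:=\bigl\{\bigl((\mathbf x,z)_L,(\mathbf x+\mathbf a,z+\|\mathbf a\|^2)_R\bigr):\ \mathbf x\in[N]^k,\ z\in[N^2],\ \mathbf x+\mathbf a\in[N]^k,\ z+\|\mathbf a\|^2\in[N^2]\bigr\}, \] where $\|\mathbf a\|^2=\sum_i a_i^2$, and let $E:=\bigcup_{\mathbf a\in A}M_{\mathbf a}$. (The PMRS family is $\{M_{\mathbf a}\}_{\mathbf a\in A}$.)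
   Context: A matching $M$ in a graph $\Gamma=(V,E)$ is positive if there is $w:V\to\mathbb{R}$ such that for every edge $\{u,v\}\in E$: $w(u)+w(v)>0$ if and only if $\{u,v\}\in M$. For $\varepsilon\in(0,1/2)$, a bipartite graph $U=(L,R;E)$ with $|L|=|R|=n_0$ is $(s,\varepsilon)$-PMRS if there exist matchings $M_1,\dots,M_s\subseteq E$ that are pairwise edge-disjoint, each of size at least $\varepsilon n_0$, and each positive in $U$. *)

theory Defs
  imports Complex_Main "HOL-Library.FuncSet" "HOL-Library.Disjoint_Sets" "HOL-Library.Landau_Symbols"
begin

text \<open>
  Edges are two-element vertex sets, and a graph is given by its vertex set(s) and its edge set.
\<close>

definition bipartite_graph :: "'v set \<Rightarrow> 'v set \<Rightarrow> 'v set set \<Rightarrow> bool" where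
  "bipartite_graph L R E \<longleftrightarrow>
     finite L \<and> finite R \<and> L \<inter> R = {} \<and> (\<forall>e\<in>E. \<exists>u\<in>L. \<exists>v\<in>R. e = {u, v})"

definition matching :: "'v set set \<Rightarrow> 'v set set \<Rightarrow> bool" where
  "matching E M \<longleftrightarrow> M \<subseteq> E \<and> (\<forall>e\<in>M. \<forall>f\<in>M. e \<noteq> f \<longrightarrow> e \<inter> f = {})"

text \<open>
  The weight is a total function on the vertex type; only its values on vertices incident
  to an edge matter.
\<close>

definition positive_matching :: "'v set set \<Rightarrow> 'v set set \<Rightarrow> bool" where
  "positive_matching E M \<longleftrightarrow> matching E M \<and>
     (\<exists>w :: 'v \<Rightarrow> real. \<forall>u v. {u, v} \<in> E \<longrightarrow> (w u + w v > 0 \<longleftrightarrow> {u, v} \<in> M))"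

definition pmrs_family ::
    "'v set set \<Rightarrow> nat \<Rightarrow> real \<Rightarrow> 'i set \<Rightarrow> ('i \<Rightarrow> 'v set set) \<Rightarrow> bool" where
  "pmrs_family E n0 \<epsilon> I M \<longleftrightarrow>
     disjoint_family_on M I \<and>
     (\<forall>i\<in>I. positive_matching E (M i) \<and> real (card (M i)) \<ge> \<epsilon> * real n0)"

definition is_PMRS ::
    "'v set \<Rightarrow> 'v set \<Rightarrow> 'v set set \<Rightarrow> nat \<Rightarrow> nat \<Rightarrow> real \<Rightarrow> bool" where
  "is_PMRS L R E n0 s \<epsilon> \<longleftrightarrow>
     0 < \<epsilon> \<and> \<epsilon> < 1 / 2 \<and>
     bipartite_graph L R E \<and> card L = n0 \<and> card R = n0 \<and>
     (\<exists>M :: nat \<Rightarrow> 'v set set. pmrs_family E n0 \<epsilon> {1..s} M)"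

text \<open>
  A vector of length \<open>k\<close> over the naturals is an extensional function on \<open>{..<k}\<close>. The two
  disjoint copies of the grid \<open>[N]\<^sup>k \<times> [N\<^sup>2]\<close> are its images under \<open>Inl\<close> and \<open>Inr\<close>.
\<close>

type_synonym point = "(nat \<Rightarrow> nat) \<times> nat"

definition vec_box :: "nat \<Rightarrow> nat \<Rightarrow> (nat \<Rightarrow> nat) set" where
  "vec_box k N = {..<k} \<rightarrow>\<^sub>E {..<N}"

definition vec_zero :: "nat \<Rightarrow> nat \<Rightarrow> nat" where
  "vec_zero k = (\<lambda>i\<in>{..<k}. 0)"

definition vec_add :: "nat \<Rightarrow> (nat \<Rightarrow> nat) \<Rightarrow> (nat \<Rightarrow> nat) \<Rightarrow> nat \<Rightarrow> nat" where
  "vec_add k x a = (\<lambda>i\<in>{..<k}. x i + a i)"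

definition norm_sq :: "nat \<Rightarrow> (nat \<Rightarrow> nat) \<Rightarrow> nat" where
  "norm_sq k a = (\<Sum>i<k. (a i)\<^sup>2)"

definition left_part :: "nat \<Rightarrow> nat \<Rightarrow> (point + point) set" where
  "left_part k N = Inl ` (vec_box k N \<times> {..<N\<^sup>2})"

definition right_part :: "nat \<Rightarrow> nat \<Rightarrow> (point + point) set" where
  "right_part k N = Inr ` (vec_box k N \<times> {..<N\<^sup>2})"

definition shifts :: "nat \<Rightarrow> nat \<Rightarrow> (nat \<Rightarrow> nat) set" where
  "shifts k P = ({..<k} \<rightarrow>\<^sub>E {0..P}) - {vec_zero k}"

definition shift_matching :: "nat \<Rightarrow> nat \<Rightarrow> (nat \<Rightarrow> nat) \<Rightarrow> (point + point) set set" where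
  "shift_matching k N a =
     {{Inl (x, z), Inr (vec_add k x a, z + norm_sq k a)} | x z.
        x \<in> vec_box k N \<and> z \<in> {..<N\<^sup>2} \<and>
        vec_add k x a \<in> vec_box k N \<and> z + norm_sq k a \<in> {..<N\<^sup>2}}"

definition edges :: "nat \<Rightarrow> nat \<Rightarrow> nat \<Rightarrow> (point + point) set set" where
  "edges k N P = (\<Union>a\<in>shifts k P. shift_matching k N a)"

definition max_shift :: "real \<Rightarrow> nat \<Rightarrow> nat" where
  "max_shift \<alpha> N = nat \<lfloor>\<alpha> * real N\<rfloor>"

end

theory Submission
  imports Defs
begin

text \<open>
  For an edge with shift \<open>b\<close>, i.e. \<open>y - x = b\<close> and \<open>t - z = \<parallel>b\<parallel>\<^sup>2\<close>, the quantity
  \<open>\<parallel>b - a\<parallel>\<^sup>2 = (t - z) - 2 a \<cdot> (y - x) + \<parallel>a\<parallel>\<^sup>2\<close> splits into a function of \<open>(x, z)\<close> plus a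
  function of \<open>(y, t)\<close>. It is a nonnegative integer vanishing only for \<open>b = a\<close>, so
  \<open>1/2 - \<parallel>b - a\<parallel>\<^sup>2\<close> is a vertex weighting that makes exactly the edges of \<open>M\<^sub>a\<close> positive.
  The size bound uses that \<open>M\<^sub>a\<close> contains the edges starting in \<open>[N - P]\<^sup>k \<times> [N\<^sup>2 - k P\<^sup>2]\<close>,
  which is more than half of the left part when \<open>P \<le> N / (4 k)\<close>.
\<close>

section \<open>Sizes of the grid and of the shift set\<close>

lemma finite_vec_box: "finite (vec_box k N)"
  by (simp add: vec_box_def finite_PiE)

lemma card_vec_box: "card (vec_box k N) = N ^ k"
  by (simp add: vec_box_def card_PiE)

lemma finite_left_part: "finite (left_part k N)"
  and finite_right_part: "finite (right_part k N)"
  by (simp_all add: left_part_def right_part_def finite_vec_box)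

lemma card_left_part: "card (left_part k N) = N ^ (k + 2)"
  and card_right_part: "card (right_part k N) = N ^ (k + 2)"
  by (simp_all add: left_part_def right_part_def card_image card_cartesian_product
      card_vec_box power_add power2_eq_square)

lemma finite_shifts: "finite (shifts k P)"
  by (simp add: shifts_def finite_PiE)

lemma card_shifts: "card (shifts k P) = (P + 1) ^ k - 1"
proof -
  have "vec_zero k \<in> {..<k} \<rightarrow>\<^sub>E {0..P}"
    by (auto simp: vec_zero_def)
  then show ?thesis
    by (simp add: shifts_def card_Diff_singleton card_PiE)
qed

section \<open>Cancellation, edge-disjointness and the matching property\<close>

lemma shifts_le: "a \<in> shifts k P \<Longrightarrow> i < k \<Longrightarrow> a i \<le> P"
  by (auto simp: shifts_def PiE_def Pi_def)

lemma shifts_extensional: "a \<in> shifts k P \<Longrightarrow> a \<in> extensional {..<k}"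
  by (auto simp: shifts_def PiE_def)

lemma vec_box_extensional: "x \<in> vec_box k N \<Longrightarrow> x \<in> extensional {..<k}"
  by (auto simp: vec_box_def PiE_def)

lemma vec_add_left_cancel:
  assumes "a \<in> extensional {..<k}" "b \<in> extensional {..<k}" "vec_add k x a = vec_add k x b"
  shows "a = b"
proof (rule extensionalityI[OF assms(1,2)])
  fix i assume "i \<in> {..<k}"
  then show "a i = b i"
    using fun_cong[OF assms(3), of i] by (simp add: vec_add_def)
qed

lemma vec_add_right_cancel:
  assumes "x \<in> extensional {..<k}" "y \<in> extensional {..<k}" "vec_add k x a = vec_add k y a"
  shows "x = y"
proof (rule extensionalityI[OF assms(1,2)])
  fix i assume "i \<in> {..<k}"
  then show "x i = y i"
    using fun_cong[OF assms(3), of i] by (simp add: vec_add_def)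
qed

lemma bipartite_graph_edges: "bipartite_graph (left_part k N) (right_part k N) (edges k N P)"
proof -
  have "left_part k N \<inter> right_part k N = {}"
    by (auto simp: left_part_def right_part_def)
  moreover have "\<exists>u\<in>left_part k N. \<exists>v\<in>right_part k N. e = {u, v}" if "e \<in> edges k N P" for e
    using that unfolding edges_def shift_matching_def left_part_def right_part_def by blast
  ultimately show ?thesis
    by (simp add: bipartite_graph_def finite_left_part finite_right_part)
qed

text \<open>The two ends of an edge determine its shift as the difference of their vectors.
  \<open>Inl\<close> and \<open>Inr\<close> tell which end is which.\<close>

lemma disjoint_family_on_shift_matching:
  "disjoint_family_on (shift_matching k N) (shifts k P)"
  unfolding disjoint_family_on_def
proof (intro ballI impI)
  fix a b assume ab: "a \<in> shifts k P" "b \<in> shifts k P" "a \<noteq> b"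
  then have "vec_add k x a \<noteq> vec_add k x b" for x
    using vec_add_left_cancel shifts_extensional by blast
  then show "shift_matching k N a \<inter> shift_matching k N b = {}"
    by (auto simp: shift_matching_def doubleton_eq_iff)
qed

text \<open>Translation by a fixed shift is injective, so distinct edges differ at both their left
  and their right ends.\<close>

lemma matching_shift_matching:
  assumes "shift_matching k N a \<subseteq> E"
  shows "matching E (shift_matching k N a)"
  unfolding matching_def
proof (intro conjI ballI impI assms)
  fix e f assume e: "e \<in> shift_matching k N a" and f: "f \<in> shift_matching k N a" and "e \<noteq> f"
  obtain x z where x: "x \<in> vec_box k N" "e = {Inl (x, z), Inr (vec_add k x a, z + norm_sq k a)}"
    using e by (auto simp: shift_matching_def)
  obtain y t where y: "y \<in> vec_box k N" "f = {Inl (y, t), Inr (vec_add k y a, t + norm_sq k a)}"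
    using f by (auto simp: shift_matching_def)
  have "x = y" if "vec_add k x a = vec_add k y a"
    using that vec_add_right_cancel x(1) y(1) vec_box_extensional by blast
  moreover have "x \<noteq> y \<or> z \<noteq> t"
    using \<open>e \<noteq> f\<close> x(2) y(2) by blast
  ultimately have "x \<noteq> y \<or> z \<noteq> t" "vec_add k x a \<noteq> vec_add k y a \<or> z \<noteq> t"
    by blast+
  then show "e \<inter> f = {}"
    unfolding x(2) y(2) by auto
qed

section \<open>Separating weights and positivity\<close>

fun separating_weight :: "nat \<Rightarrow> (nat \<Rightarrow> nat) \<Rightarrow> point + point \<Rightarrow> real" where
  "separating_weight k a (Inl (x, z)) = real z - 2 * (\<Sum>i<k. real (a i) * real (x i))"
| "separating_weight k a (Inr (y, t)) =
     2 * (\<Sum>i<k. real (a i) * real (y i)) - real t - real (norm_sq k a) + 1 / 2"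

lemma separating_weight_edge:
  "separating_weight k a (Inl (x, z)) + separating_weight k a (Inr (vec_add k x b, z + norm_sq k b))
     = 1 / 2 - (\<Sum>i<k. (real (b i) - real (a i))\<^sup>2)"
  by (simp add: norm_sq_def vec_add_def power2_eq_square algebra_simps sum.distrib
      sum_subtractf sum_distrib_left)

lemma separating_weight_pos_iff:
  assumes "a \<in> extensional {..<k}" "b \<in> extensional {..<k}"
  shows "separating_weight k a (Inl (x, z))
      + separating_weight k a (Inr (vec_add k x b, z + norm_sq k b)) > 0 \<longleftrightarrow> b = a"
proof
  assume "b = a"
  then show "separating_weight k a (Inl (x, z))
      + separating_weight k a (Inr (vec_add k x b, z + norm_sq k b)) > 0"
    unfolding separating_weight_edge by simp
next
  assume pos: "separating_weight k a (Inl (x, z))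
      + separating_weight k a (Inr (vec_add k x b, z + norm_sq k b)) > 0"
  \<comment> \<open>The sum is recast over the integers, where a nonnegative value below 1/2 must be
    0.\<close>
  define D where "D = (\<Sum>i<k. (int (b i) - int (a i))\<^sup>2)"
  have "real_of_int D < 1 / 2"
    using pos unfolding separating_weight_edge D_def by simp
  then have "D < 1"
    by linarith
  moreover have "D \<ge> 0"
    by (simp add: D_def sum_nonneg)
  ultimately have "D = 0"
    by simp
  then have "\<forall>i\<in>{..<k}. (int (b i) - int (a i))\<^sup>2 = 0"
    unfolding D_def by (subst (asm) sum_nonneg_eq_0_iff) auto
  then show "b = a"
    by (intro extensionalityI[OF assms(2,1)]) auto
qed

lemma positive_matching_shift_matching:
  assumes a: "a \<in> shifts k P"
  shows "positive_matching (edges k N P) (shift_matching k N a)"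
  unfolding positive_matching_def
proof (intro conjI exI[of _ "separating_weight k a"] allI impI)
  show "matching (edges k N P) (shift_matching k N a)"
    using a by (intro matching_shift_matching) (auto simp: edges_def)
next
  fix u v assume uv: "{u, v} \<in> edges k N P"
  obtain b where b: "b \<in> shifts k P" "{u, v} \<in> shift_matching k N b"
    using uv by (auto simp: edges_def)
  obtain x z where xz: "{u, v} = {Inl (x, z), Inr (vec_add k x b, z + norm_sq k b)}"
    using b(2) by (auto simp: shift_matching_def)
  \<comment> \<open>Either of \<open>u\<close>, \<open>v\<close> may be the left end; the weight sum
    is symmetric.\<close>
  have "separating_weight k a u + separating_weight k a v =
      separating_weight k a (Inl (x, z))
      + separating_weight k a (Inr (vec_add k x b, z + norm_sq k b))"
    using xz by (auto simp only: doubleton_eq_iff add.commute)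
  then have "separating_weight k a u + separating_weight k a v > 0 \<longleftrightarrow> b = a"
    using separating_weight_pos_iff[OF shifts_extensional[OF a] shifts_extensional[OF b(1)]]
    by metis
  \<comment> \<open>The edge lies in the matching of \<open>b\<close>, hence by disjointness in that
    of no other shift.\<close>
  also have "b = a \<longleftrightarrow> {u, v} \<in> shift_matching k N a"
    using disjoint_family_onD[OF disjoint_family_on_shift_matching b(1) a] b(2) by blast
  finally show "separating_weight k a u + separating_weight k a v > 0
      \<longleftrightarrow> {u, v} \<in> shift_matching k N a" .
qed

section \<open>Size of the matchings\<close>

lemma norm_sq_le:
  assumes "a \<in> shifts k P"
  shows "norm_sq k a \<le> k * P\<^sup>2"
proof -
  have "norm_sq k a \<le> (\<Sum>i<k. P\<^sup>2)"
    unfolding norm_sq_def by (intro sum_mono power_mono) (auto intro: shifts_le[OF assms])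
  then show ?thesis
    by simp
qed

lemma finite_shift_matching: "finite (shift_matching k N a)"
proof (rule finite_subset)
  show "shift_matching k N a \<subseteq> (\<lambda>(x, z). {Inl (x, z), Inr (vec_add k x a, z + norm_sq k a)})
      ` (vec_box k N \<times> {..<N\<^sup>2})"
    by (auto simp: shift_matching_def)
qed (simp add: finite_vec_box)

lemma card_shift_matching_ge:
  assumes a: "a \<in> shifts k P"
  shows "card (shift_matching k N a) \<ge> (N - P) ^ k * (N\<^sup>2 - k * P\<^sup>2)"
proof -
  let ?e = "\<lambda>(x, z). {Inl (x, z), Inr (vec_add k x a, z + norm_sq k a)} :: (point + point) set"
  let ?S = "vec_box k (N - P) \<times> {..<N\<^sup>2 - k * P\<^sup>2}"
  \<comment> \<open>The left end of an edge already determines its starting point.\<close>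
  have inj: "inj_on ?e ?S"
    by (auto simp: inj_on_def doubleton_eq_iff)
  have "?e (x, z) \<in> shift_matching k N a" if x: "x \<in> vec_box k (N - P)" and z: "z < N\<^sup>2 - k * P\<^sup>2"
    for x z
  proof -
    \<comment> \<open>Truncated subtraction is harmless: \<open>x i < N - P\<close> yields
      \<open>x i + P < N\<close>, which leaves room for any coordinate of the shift.\<close>
    have lt: "x i < N - P" if "i < k" for i
      using x that by (auto simp: vec_box_def PiE_def Pi_def)
    have "x i < N" "x i + a i < N" if "i < k" for i
      using lt[OF that] shifts_le[OF a that] by auto
    then have "x \<in> vec_box k N" "vec_add k x a \<in> vec_box k N"
      using vec_box_extensional[OF x]
      by (auto simp: vec_box_def vec_add_def PiE_def Pi_def)
    moreover have "z < N\<^sup>2" "z + norm_sq k a < N\<^sup>2"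
      using z norm_sq_le[OF a] by linarith+
    ultimately show ?thesis
      unfolding shift_matching_def mem_Collect_eq lessThan_iff case_prod_conv
      by (intro exI[of _ x] exI[of _ z] conjI refl)
  qed
  then have "?e ` ?S \<subseteq> shift_matching k N a"
    by auto
  then have "card ?S \<le> card (shift_matching k N a)"
    using card_inj_on_le[OF inj] finite_shift_matching by blast
  then show ?thesis
    by (simp add: card_cartesian_product card_vec_box)
qed

text \<open>Both factors keep at least 3/4 of their full size, and 9/16 exceeds 1/2.\<close>

lemma half_grid_bound:
  fixes N P k :: nat
  assumes k: "k \<ge> 1" and P: "real P \<le> real N / (4 * real k)"
  shows "real ((N - P) ^ k * (N\<^sup>2 - k * P\<^sup>2)) \<ge> 1 / 2 * real (N ^ (k + 2))"
proof -
  define c where "c = 1 / (4 * real k)"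
  have c: "0 \<le> c" "c \<le> 1 / 4" "real k * c = 1 / 4"
    using k by (auto simp: c_def field_simps)
  have PN: "real P \<le> c * real N"
    using P by (simp add: c_def)
  \<comment> \<open>Bernoulli bounds the loss over all \<open>k\<close> coordinates together by
    \<open>k * c\<close>, that is, by 1/4.\<close>
  have "1 + real k * (- c) \<le> (1 + (- c)) ^ k"
    using c by (intro Bernoulli_inequality) simp
  then have "3 / 4 \<le> (1 - c) ^ k"
    using c by simp
  then have "3 / 4 * real N ^ k \<le> (1 - c) ^ k * real N ^ k"
    by (rule mult_right_mono) simp
  also have "\<dots> = (real N - c * real N) ^ k"
    by (simp add: power_mult_distrib[symmetric] algebra_simps)
  also have "\<dots> \<le> real (N - P) ^ k"
  proof (rule power_mono)
    show "real N - c * real N \<le> real (N - P)"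
      using PN by linarith
    show "0 \<le> real N - c * real N"
      using mult_right_mono[OF c(2), of "real N"] by simp
  qed
  finally have 1: "3 / 4 * real N ^ k \<le> real (N - P) ^ k" .
  have "real (k * P\<^sup>2) \<le> real k * (c * real N)\<^sup>2"
    using PN by (simp add: mult_left_mono power_mono)
  \<comment> \<open>One factor \<open>c\<close> combines with \<open>k\<close> to 1/4; the other is
    at most 1.\<close>
  also have "\<dots> = (real k * c) * c * (real N)\<^sup>2"
    by (simp add: power2_eq_square)
  also have "\<dots> \<le> 1 / 4 * (real N)\<^sup>2"
    unfolding c(3) using c(2) by (intro mult_right_mono) auto
  finally have "real (k * P\<^sup>2) \<le> 1 / 4 * real (N\<^sup>2)"
    by simp
  then have "3 / 4 * real (N\<^sup>2) \<le> real (N\<^sup>2 - k * P\<^sup>2)"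
    by linarith
  then have "(3 / 4 * real N ^ k) * (3 / 4 * real (N\<^sup>2)) \<le> real (N - P) ^ k * real (N\<^sup>2 - k * P\<^sup>2)"
    using 1 by (intro mult_mono) auto
  moreover have "1 / 2 * real (N ^ (k + 2)) \<le> (3 / 4 * real N ^ k) * (3 / 4 * real (N\<^sup>2))"
    by (simp add: power_add power2_eq_square)
  ultimately show ?thesis
    by simp
qed

section \<open>Assembling the PMRS family\<close>

lemma pmrs_family_shift_matching:
  assumes "k \<ge> 1" "real P \<le> real N / (4 * real k)" "\<epsilon> \<le> 1 / 2"
  shows "pmrs_family (edges k N P) (N ^ (k + 2)) \<epsilon> (shifts k P) (shift_matching k N)"
  unfolding pmrs_family_def
proof (intro conjI ballI disjoint_family_on_shift_matching)
  fix a assume a: "a \<in> shifts k P"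
  then show "positive_matching (edges k N P) (shift_matching k N a)"
    by (rule positive_matching_shift_matching)
  \<comment> \<open>Each matching has at least half as many edges as one side has vertices, which
    covers every admissible \<epsilon> at once.\<close>
  have "\<epsilon> * real (N ^ (k + 2)) \<le> 1 / 2 * real (N ^ (k + 2))"
    using assms(3) by (intro mult_right_mono) auto
  also have "\<dots> \<le> real ((N - P) ^ k * (N\<^sup>2 - k * P\<^sup>2))"
    by (rule half_grid_bound[OF assms(1,2)])
  also have "\<dots> \<le> real (card (shift_matching k N a))"
    using card_shift_matching_ge[OF a] by (simp only: of_nat_le_iff)
  finally show "\<epsilon> * real (N ^ (k + 2)) \<le> real (card (shift_matching k N a))" .
qed

text \<open>Bridges the family indexed by shift vectors and the numbering by \<open>{1..s}\<close>
  in \<open>is_PMRS\<close>; injectivity of \<open>h\<close> preserves disjointness.\<close>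

lemma pmrs_family_reindex:
  assumes "pmrs_family E n \<epsilon> I M" "bij_betw h J I"
  shows "pmrs_family E n \<epsilon> J (M \<circ> h)"
proof -
  have "h j \<in> I" if "j \<in> J" for j
    using assms(2) that by (rule bij_betwE[rule_format])
  moreover have "h i \<noteq> h j" if "i \<in> J" "j \<in> J" "i \<noteq> j" for i j
    using assms(2) that by (auto simp: bij_betw_def inj_on_def)
  ultimately show ?thesis
    using assms(1) unfolding pmrs_family_def disjoint_family_on_def by simp
qed

lemma is_PMRS_edges:
  assumes "k \<ge> 1" "real P \<le> real N / (4 * real k)" "0 < \<epsilon>" "\<epsilon> < 1 / 2"
  shows "is_PMRS (left_part k N) (right_part k N) (edges k N P) (N ^ (k + 2))
    (card (shifts k P)) \<epsilon>"
proof -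
  obtain h where "bij_betw h {1..card (shifts k P)} (shifts k P)"
    using ex_bij_betw_nat_finite_1[OF finite_shifts] by blast
  then have "pmrs_family (edges k N P) (N ^ (k + 2)) \<epsilon> {1..card (shifts k P)}
      (shift_matching k N \<circ> h)"
    using assms by (intro pmrs_family_reindex[OF pmrs_family_shift_matching]) auto
  then show ?thesis
    using assms
    by (auto simp: is_PMRS_def bipartite_graph_edges card_left_part card_right_part)
qed

section \<open>Growth of the number of shifts\<close>

lemma max_shift_le: "\<alpha> \<ge> 0 \<Longrightarrow> real (max_shift \<alpha> N) \<le> \<alpha> * real N"
  by (simp add: max_shift_def)

lemma less_max_shift_Suc: "\<alpha> * real N < real (max_shift \<alpha> N + 1)"
  unfolding max_shift_def by linarith

lemma eventually_max_shift_ge: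
  assumes "\<alpha> > 0"
  shows "\<forall>\<^sub>F N in sequentially. max_shift \<alpha> N \<ge> 1"
  using eventually_ge_at_top[of "nat \<lceil>1 / \<alpha>\<rceil>"]
proof eventually_elim
  case (elim N)
  then have "1 / \<alpha> \<le> real N"
    by linarith
  then have "1 \<le> \<alpha> * real N"
    using assms by (simp add: field_simps)
  then show ?case
    unfolding max_shift_def by linarith
qed

lemma card_shifts_bigomega:
  assumes "\<alpha> > 0" "k \<ge> 1"
  shows "(\<lambda>N. real (card (shifts k (max_shift \<alpha> N)))) \<in> \<Omega>(\<lambda>N. real N ^ k)"
proof (rule landau_omega.bigI)
  \<comment> \<open>The factor \<open>\<alpha> ^ k\<close> comes from
    \<open>P + 1 > \<alpha> * N\<close>; the factor 1/2 absorbs the removed zero vector, since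
    \<open>(P + 1) ^ k\<close> is at least 2.\<close>
  show "\<alpha> ^ k / 2 > 0"
    using assms by simp
  show "\<forall>\<^sub>F N in sequentially. norm (real (card (shifts k (max_shift \<alpha> N))))
      \<ge> \<alpha> ^ k / 2 * norm (real N ^ k)"
    using eventually_max_shift_ge[OF assms(1)]
  proof eventually_elim
    case (elim N)
    let ?Q = "max_shift \<alpha> N + 1"
    have "(\<alpha> * real N) ^ k \<le> real ?Q ^ k"
      using less_max_shift_Suc[of \<alpha> N] assms by (intro power_mono) auto
    moreover have "?Q ^ 1 \<le> ?Q ^ k"
      using assms(2) by (intro power_increasing) auto
    then have "2 \<le> ?Q ^ k"
      using elim by simp
    then have "real (?Q ^ k) / 2 \<le> real (?Q ^ k - 1)"
      by linarith
    ultimately have "(\<alpha> * real N) ^ k / 2 \<le> real (card (shifts k (max_shift \<alpha> N)))"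
      unfolding card_shifts of_nat_power by linarith
    then show ?case
      by (simp add: power_mult_distrib)
  qed
qed

theorem theorem3p9:
  fixes \<epsilon> :: real and k :: nat
  assumes "0 < \<epsilon>" and "\<epsilon> < 1 / 2" and "k \<ge> 2"
  shows "\<exists>\<alpha>::real. \<alpha> > 0 \<and>
    (\<forall>\<^sub>F N in sequentially.
       max_shift \<alpha> N \<ge> 1 \<and>
       card (shifts k (max_shift \<alpha> N)) = (max_shift \<alpha> N + 1) ^ k - 1 \<and>
       is_PMRS (left_part k N) (right_part k N) (edges k N (max_shift \<alpha> N))
         (N ^ (k + 2)) (card (shifts k (max_shift \<alpha> N))) \<epsilon> \<and>
       pmrs_family (edges k N (max_shift \<alpha> N)) (N ^ (k + 2)) \<epsilon>
         (shifts k (max_shift \<alpha> N)) (shift_matching k N)) \<and>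
    (\<lambda>N. real (card (shifts k (max_shift \<alpha> N))))
       \<in> \<Omega>(\<lambda>N. real (N ^ (k + 2)) powr (real k / real (k + 2))) \<and>
    (k = 2 \<longrightarrow>
       (\<lambda>N. real (card (shifts k (max_shift \<alpha> N)))) \<in> \<Omega>(\<lambda>N. sqrt (real (N ^ (k + 2)))))"
proof -
  \<comment> \<open>The ratio allowed by \<open>half_grid_bound\<close>; one value serves all
    \<epsilon>.\<close>
  define \<alpha> where "\<alpha> = 1 / (4 * real k)"
  have \<alpha>: "\<alpha> > 0"
    using assms(3) by (simp add: \<alpha>_def)
  have P: "real (max_shift \<alpha> N) \<le> real N / (4 * real k)" for N
    using max_shift_le[of \<alpha> N] \<alpha> by (simp add: \<alpha>_def)
  have k: "k \<ge> 1"
    using assms(3) by simp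
  note omega = card_shifts_bigomega[OF \<alpha> k]
  \<comment> \<open>The exponents multiply to \<open>(k + 2) * (k / (k + 2)) = k\<close>; positive
    \<open>N\<close> permits passing between \<open>powr\<close> and powers.\<close>
  have "\<forall>\<^sub>F N in sequentially. real N ^ k = real (N ^ (k + 2)) powr (real k / real (k + 2))"
    using eventually_gt_at_top[of 0]
  proof eventually_elim
    case (elim N)
    then have "real (N ^ (k + 2)) = real N powr real (k + 2)"
      by (simp only: of_nat_power powr_realpow of_nat_0_less_iff)
    then have "real (N ^ (k + 2)) powr (real k / real (k + 2)) = real N powr real k"
      by (simp add: powr_powr)
    then show ?case
      using elim by (simp add: powr_realpow)
  qed
  then have powr_omega: "(\<lambda>N. real (card (shifts k (max_shift \<alpha> N))))
      \<in> \<Omega>(\<lambda>N. real (N ^ (k + 2)) powr (real k / real (k + 2)))"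
    using omega by (subst (asm) landau_omega.big.cong)
  have sqrt_omega: "(\<lambda>N. real (card (shifts k (max_shift \<alpha> N)))) \<in> \<Omega>(\<lambda>N. sqrt (real (N ^ (k + 2))))"
    if "k = 2"
  proof -
    \<comment> \<open>For \<open>k = 2\<close> the radicand is the fourth power of \<open>N\<close>,
      the square of \<open>N ^ k\<close>.\<close>
    have "sqrt (real (N ^ (k + 2))) = real N ^ k" for N
      by (rule real_sqrt_unique) (simp_all add: that flip: power_mult)
    then show ?thesis
      using omega by (simp only:)
  qed
  have "\<forall>\<^sub>F N in sequentially.
       max_shift \<alpha> N \<ge> 1 \<and>
       card (shifts k (max_shift \<alpha> N)) = (max_shift \<alpha> N + 1) ^ k - 1 \<and>
       is_PMRS (left_part k N) (right_part k N) (edges k N (max_shift \<alpha> N))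
         (N ^ (k + 2)) (card (shifts k (max_shift \<alpha> N))) \<epsilon> \<and>
       pmrs_family (edges k N (max_shift \<alpha> N)) (N ^ (k + 2)) \<epsilon>
         (shifts k (max_shift \<alpha> N)) (shift_matching k N)"
    \<comment> \<open>Large \<open>N\<close> secures only \<open>P \<ge> 1\<close>; the other
      conjuncts hold for each \<open>N\<close>.\<close>
    using eventually_max_shift_ge[OF \<alpha>]
    by (rule eventually_mono) (intro conjI card_shifts is_PMRS_edges[OF k P assms(1,2)]
        pmrs_family_shift_matching[OF k P less_imp_le[OF assms(2)]])
  then show ?thesis
    by (intro exI[of _ \<alpha>] conjI impI \<alpha> powr_omega sqrt_omega)
qed

end
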